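(* Let $(C_\bullet,\partial^C_\bullet)$ and $(D_\bullet,\partial^D_\bullet)$ be chain complexes of finite-dimensional real vector spaces (indexed by $\mathbb{N}$), each space being equipped with an inner product. For any chain map $f:C\to D$ and any $k\in\mathbb{N}$, define $\hat f_k=\pi_k^D f_k i_k^C:\mathcal{H}_k^C\to\mathcal{H}_k^D$, where $i_k^C$ is the natural inclusion of the space of $k$-harmonics $\mathcal{H}_k^C$ into $C_k$ and $\pi_k^D$ is the orthogonal projection of $D_k$ onto $\mathcal{H}_k^D$. Then $$\psi_k^D\circ\hat f_k=\widetilde f_k\circ\psi_k^C,$$ where $\widetilde f_k:H_k^C\to H_k^D$ is the map induced by $f$ in degree-$k$ homology and $\psi_k^C:\mathcal{H}_k^C\to H_k^C$, $\psi_k^D:\mathcal{H}_k^D\to H_k^D$ are the maps $h\mapsto[h]$.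
   Context: A chain complex is a sequence of vector spaces and linear maps $\cdots\to C_{k+1}\xrightarrow{\partial_{k+1}}C_k\xrightarrow{\partial_k}C_{k-1}\to\cdots\to C_0\xrightarrow{\partial_0}0$ with $\partial_k\partial_{k+1}=0$; $H_k=\ker(\partial_k)/\operatorname{im}(\partial_{k+1})$. A chain map $f$ is a collection of linear maps $f_k:C_k\to D_k$ commuting with the boundary maps. Let $\partial_k^*:C_{k-1}\to C_k$ be the adjoint of $\partial_k$ with respect to the chosen inner products. The Hodge Laplacian in degree $k$ is $L_k=\partial_{k+1}\partial_{k+1}^*+\partial_k^*\partial_k:C_k\to C_k$, and the space of $k$-harmonics is $\mathcal{H}_k=\ker(L_k)$. Every $h\in\mathcal{H}_k$ is a cycle, and $[h]\in H_k$ denotes its homology class; the linear map $\psi_k:\mathcal{H}_k\to H_k$, $\psi_k(h)=[h]$, is an isomorphism. Superscripts $C$, $D$ indicate the complex. *)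

theory Defs
  imports "HOL-Analysis.Analysis"
begin

text \<open>
  The spaces of a complex are finite-dimensional subspaces of one ambient real vector space
  (possibly of infinite dimension), so that their dimensions may vary with the degree and may be
  zero. Every sequence of real vector spaces is of this form: embed it into its direct sum.
  Maps and inner products are total functions, constrained only on the relevant subspaces.
\<close>

definition linear_between :: "'a::real_vector set \<Rightarrow> 'b::real_vector set \<Rightarrow> ('a \<Rightarrow> 'b) \<Rightarrow> bool" where
  "linear_between U V g \<longleftrightarrow>
     (\<forall>x\<in>U. g x \<in> V) \<and>
     (\<forall>x\<in>U. \<forall>y\<in>U. g (x + y) = g x + g y) \<and>
     (\<forall>c. \<forall>x\<in>U. g (c *\<^sub>R x) = c *\<^sub>R g x)"

definition inner_product_on :: "'a::real_vector set \<Rightarrow> ('a \<Rightarrow> 'a \<Rightarrow> real) \<Rightarrow> bool" where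
  "inner_product_on V ip \<longleftrightarrow>
     (\<forall>x\<in>V. \<forall>y\<in>V. ip x y = ip y x) \<and>
     (\<forall>x\<in>V. \<forall>y\<in>V. \<forall>z\<in>V. ip (x + y) z = ip x z + ip y z) \<and>
     (\<forall>c. \<forall>x\<in>V. \<forall>y\<in>V. ip (c *\<^sub>R x) y = c * ip x y) \<and>
     (\<forall>x\<in>V. x \<noteq> 0 \<longrightarrow> ip x x > 0)"

definition fin_dim_subspace :: "'a::real_vector set \<Rightarrow> bool" where
  "fin_dim_subspace V \<longleftrightarrow> (\<exists>B. finite B \<and> V = span B)"

record 'a ip_complex =
  chain_space :: "nat \<Rightarrow> 'a set"
  bd :: "nat \<Rightarrow> 'a \<Rightarrow> 'a"
  ip :: "nat \<Rightarrow> 'a \<Rightarrow> 'a \<Rightarrow> real"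

definition bd_target :: "'a::real_vector ip_complex \<Rightarrow> nat \<Rightarrow> 'a set" where
  "bd_target K k = (case k of 0 \<Rightarrow> {0} | Suc j \<Rightarrow> chain_space K j)"

definition chain_complex :: "'a::real_vector ip_complex \<Rightarrow> bool" where
  "chain_complex K \<longleftrightarrow>
     (\<forall>k. fin_dim_subspace (chain_space K k)) \<and>
     (\<forall>k. inner_product_on (chain_space K k) (ip K k)) \<and>
     (\<forall>k. linear_between (chain_space K k) (bd_target K k) (bd K k)) \<and>
     (\<forall>k. \<forall>x\<in>chain_space K (Suc k). bd K k (bd K (Suc k) x) = 0)"

text \<open>Compatibility in degree 0 is automatic, as both boundary maps there are zero.\<close>

definition chain_map ::
  "'a::real_vector ip_complex \<Rightarrow> 'b::real_vector ip_complex \<Rightarrow> (nat \<Rightarrow> 'a \<Rightarrow> 'b) \<Rightarrow> bool" where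
  "chain_map C D f \<longleftrightarrow>
     (\<forall>k. linear_between (chain_space C k) (chain_space D k) (f k)) \<and>
     (\<forall>k. \<forall>x\<in>chain_space C (Suc k). f k (bd C (Suc k) x) = bd D (Suc k) (f (Suc k) x))"

definition adjoint_on ::
  "'a::real_vector set \<Rightarrow> ('a \<Rightarrow> 'a \<Rightarrow> real) \<Rightarrow> ('b::real_vector \<Rightarrow> 'b \<Rightarrow> real) \<Rightarrow> ('a \<Rightarrow> 'b) \<Rightarrow> 'b \<Rightarrow> 'a" where
  "adjoint_on U ipU ipV g y = (THE x. x \<in> U \<and> (\<forall>u\<in>U. ipV (g u) y = ipU u x))"

text \<open>
  For \<open>k = 0\<close> the target of the boundary map is \<open>{0}\<close>; the form \<open>ip K (0 - 1) = ip K 0\<close> restricts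
  to the only inner product on that space.
\<close>

definition bd_adj :: "'a::real_vector ip_complex \<Rightarrow> nat \<Rightarrow> 'a \<Rightarrow> 'a" where
  "bd_adj K k = adjoint_on (chain_space K k) (ip K k) (ip K (k - 1)) (bd K k)"

definition laplacian :: "'a::real_vector ip_complex \<Rightarrow> nat \<Rightarrow> 'a \<Rightarrow> 'a" where
  "laplacian K k x = bd K (k + 1) (bd_adj K (k + 1) x) + bd_adj K k (bd K k x)"

definition harmonics :: "'a::real_vector ip_complex \<Rightarrow> nat \<Rightarrow> 'a set" where
  "harmonics K k = {x \<in> chain_space K k. laplacian K k x = 0}"

definition cycles :: "'a::real_vector ip_complex \<Rightarrow> nat \<Rightarrow> 'a set" where
  "cycles K k = {x \<in> chain_space K k. bd K k x = 0}"

definition boundaries :: "'a::real_vector ip_complex \<Rightarrow> nat \<Rightarrow> 'a set" where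
  "boundaries K k = bd K (k + 1) ` chain_space K (k + 1)"

definition homologous :: "'a::real_vector ip_complex \<Rightarrow> nat \<Rightarrow> ('a \<times> 'a) set" where
  "homologous K k = {(x, y). x \<in> cycles K k \<and> y \<in> cycles K k \<and> x - y \<in> boundaries K k}"

definition homology :: "'a::real_vector ip_complex \<Rightarrow> nat \<Rightarrow> 'a set set" where
  "homology K k = cycles K k // homologous K k"

definition hom_class :: "'a::real_vector ip_complex \<Rightarrow> nat \<Rightarrow> 'a \<Rightarrow> 'a set" where
  "hom_class K k z = homologous K k `` {z}"

text \<open>
  The map on homology classes sending \<open>[z]\<close> to \<open>[f z]\<close>; the classes in the union coincide, see
  \<open>induced_hom_class\<close> below.
\<close>

definition induced ::
  "'a::real_vector ip_complex \<Rightarrow> 'b::real_vector ip_complex \<Rightarrow> (nat \<Rightarrow> 'a \<Rightarrow> 'b) \<Rightarrow> nat \<Rightarrow> 'a set \<Rightarrow> 'b set" where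
  "induced C D f k X = (\<Union>z\<in>X. hom_class D k (f k z))"

definition psi :: "'a::real_vector ip_complex \<Rightarrow> nat \<Rightarrow> 'a \<Rightarrow> 'a set" where
  "psi K k h = hom_class K k h"

definition orth_proj :: "('a::real_vector \<Rightarrow> 'a \<Rightarrow> real) \<Rightarrow> 'a set \<Rightarrow> 'a \<Rightarrow> 'a" where
  "orth_proj ipV S x = (THE p. p \<in> S \<and> (\<forall>s\<in>S. ipV (x - p) s = 0))"

definition harmonic_map ::
  "'a::real_vector ip_complex \<Rightarrow> 'b::real_vector ip_complex \<Rightarrow> (nat \<Rightarrow> 'a \<Rightarrow> 'b) \<Rightarrow> nat \<Rightarrow> 'a \<Rightarrow> 'b" where
  "harmonic_map C D f k h = orth_proj (ip D k) (harmonics D k) (f k h)"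

lemma linear_between_diff:
  assumes g: "linear_between U V g" and U: "subspace U" and xy: "x \<in> U" "y \<in> U"
  shows "g (x - y) = g x - g y"
proof -
  have "g (x + (-1) *\<^sub>R y) = g x + g ((-1) *\<^sub>R y)"
    using g xy subspace_scale[OF U] unfolding linear_between_def by blast
  also have "g ((-1) *\<^sub>R y) = (-1) *\<^sub>R g y"
    using g xy unfolding linear_between_def by blast
  finally show ?thesis by simp
qed

lemma linear_between_zero:
  assumes g: "linear_between U V g" and U: "subspace U"
  shows "g 0 = 0"
  using linear_between_diff[OF g U, of 0 0] subspace_0[OF U] by simp

lemma subspace_image_between:
  assumes g: "linear_between U V g" and U: "subspace U"
  shows "subspace (g ` U)"
proof -
  have "g x + g y \<in> g ` U" if "x \<in> U" "y \<in> U" for x y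
  proof (rule image_eqI)
    show "g x + g y = g (x + y)" using g that by (simp add: linear_between_def)
    show "x + y \<in> U" using subspace_add[OF U that] .
  qed
  moreover have "c *\<^sub>R g x \<in> g ` U" if "x \<in> U" for c x
  proof (rule image_eqI)
    show "c *\<^sub>R g x = g (c *\<^sub>R x)" using g that by (simp add: linear_between_def)
    show "c *\<^sub>R x \<in> U" using subspace_scale[OF U that] .
  qed
  moreover have "0 \<in> g ` U"
    using linear_between_zero[OF g U] subspace_0[OF U] by (rule image_eqI[OF sym])
  ultimately show ?thesis by (auto simp: subspace_def)
qed

lemma chain_complexD:
  assumes "chain_complex K"
  shows "subspace (chain_space K k)" and "linear_between (chain_space K k) (bd_target K k) (bd K k)"
proof -
  have "fin_dim_subspace (chain_space K k)" using assms by (simp add: chain_complex_def)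
  then show "subspace (chain_space K k)" by (auto simp: fin_dim_subspace_def)
  show "linear_between (chain_space K k) (bd_target K k) (bd K k)"
    using assms by (simp add: chain_complex_def)
qed

lemma equiv_homologous:
  assumes K: "chain_complex K"
  shows "equiv (cycles K k) (homologous K k)"
proof -
  have B: "subspace (boundaries K k)"
    unfolding boundaries_def
    by (rule subspace_image_between[OF chain_complexD(2)[OF K] chain_complexD(1)[OF K]])
  have "refl_on (cycles K k) (homologous K k)"
    using subspace_0[OF B] by (auto simp: refl_on_def homologous_def)
  moreover have "homologous K k \<subseteq> cycles K k \<times> cycles K k"
    by (auto simp: homologous_def)
  moreover have "sym (homologous K k)"
  proof (rule symI)
    fix x y assume "(x, y) \<in> homologous K k"
    then show "(y, x) \<in> homologous K k"
      using subspace_neg[OF B, of "x - y"] by (simp add: homologous_def)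
  qed
  moreover have "trans (homologous K k)"
  proof (rule transI)
    fix x y z assume "(x, y) \<in> homologous K k" "(y, z) \<in> homologous K k"
    then show "(x, z) \<in> homologous K k"
      using subspace_add[OF B, of "x - y" "y - z"] by (simp add: homologous_def)
  qed
  ultimately show ?thesis by (simp add: equiv_def)
qed

lemma chain_map_homologous:
  assumes C: "chain_complex C" and D: "chain_complex D" and f: "chain_map C D f"
    and xy: "(x, y) \<in> homologous C k"
  shows "(f k x, f k y) \<in> homologous D k"
proof -
  have lin: "linear_between (chain_space C j) (chain_space D j) (f j)" for j
    using f unfolding chain_map_def by blast
  have cyc: "f k z \<in> cycles D k" if z: "z \<in> cycles C k" for z
  proof -
    have zC: "z \<in> chain_space C k" "bd C k z = 0" using z by (auto simp: cycles_def)
    then have fz: "f k z \<in> chain_space D k" using lin by (auto simp: linear_between_def)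
    moreover have "bd D k (f k z) = 0"
    proof (cases k)
      case 0
      then show ?thesis
        using chain_complexD(2)[OF D, of 0] fz by (auto simp: linear_between_def bd_target_def)
    next
      case (Suc j)
      then have "bd D k (f k z) = f j (bd C k z)"
        using f zC(1) unfolding chain_map_def by metis
      then show ?thesis
        using zC linear_between_zero[OF lin chain_complexD(1)[OF C]] by simp
    qed
    ultimately show ?thesis by (simp add: cycles_def)
  qed
  have x: "x \<in> cycles C k" and y: "y \<in> cycles C k" using xy by (auto simp: homologous_def)
  obtain w where w: "w \<in> chain_space C (Suc k)" "x - y = bd C (Suc k) w"
    using xy by (auto simp: homologous_def boundaries_def)
  have "f k x - f k y = f k (x - y)"
    using linear_between_diff[OF lin chain_complexD(1)[OF C]] x y by (auto simp: cycles_def)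
  also have "\<dots> = bd D (Suc k) (f (Suc k) w)"
    using f w unfolding chain_map_def by metis
  finally have "f k x - f k y \<in> boundaries D k"
    using w(1) lin[of "Suc k"] by (auto simp: boundaries_def linear_between_def)
  with cyc[OF x] cyc[OF y] show ?thesis by (simp add: homologous_def)
qed

lemma induced_hom_class:
  assumes C: "chain_complex C" and D: "chain_complex D" and f: "chain_map C D f"
    and z: "z \<in> cycles C k"
  shows "induced C D f k (hom_class C k z) = hom_class D k (f k z)"
proof -
  have "(z, z) \<in> homologous C k"
    using equiv_class_self[OF equiv_homologous[OF C] z] by blast
  moreover have "hom_class D k (f k y) = hom_class D k (f k z)" if "(z, y) \<in> homologous C k" for y
    using equiv_class_eq[OF equiv_homologous[OF D] chain_map_homologous[OF C D f that]]
    by (simp add: hom_class_def)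
  ultimately have "(\<Union>y\<in>homologous C k `` {z}. hom_class D k (f k y)) = hom_class D k (f k z)"
    by blast
  then show ?thesis by (simp add: induced_def hom_class_def[of C])
qed

end

theory Submission
  imports Defs
begin

text \<open>
  Pairing \<open>L h\<close> with \<open>h\<close> shows that the harmonics are exactly the cycles orthogonal to the
  boundaries. Hence, for a cycle \<open>z\<close> with orthogonal projection \<open>b\<close> onto the boundaries, \<open>z - b\<close> is
  harmonic and \<open>b\<close> is orthogonal to all harmonics. So projecting \<open>z\<close> onto the harmonics only
  subtracts a boundary; apply this to \<open>z = f h\<close>.
\<close>

section \<open>Inner products on a subspace: Riesz representation, projections, adjoints\<close>

locale ip_subspace =
  fixes V :: "'a::real_vector set" and ip :: "'a \<Rightarrow> 'a \<Rightarrow> real"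
  assumes subsp: "subspace V" and inner: "inner_product_on V ip"
begin

lemmas closed [simp] =
  subspace_0[OF subsp] subspace_add[OF subsp] subspace_diff[OF subsp] subspace_scale[OF subsp]

lemma sym: "x \<in> V \<Longrightarrow> y \<in> V \<Longrightarrow> ip x y = ip y x"
  using inner by (simp add: inner_product_on_def)

lemma add_left: "x \<in> V \<Longrightarrow> y \<in> V \<Longrightarrow> z \<in> V \<Longrightarrow> ip (x + y) z = ip x z + ip y z"
  using inner[unfolded inner_product_on_def, THEN conjunct2, THEN conjunct1] by simp

lemma scale_left: "x \<in> V \<Longrightarrow> y \<in> V \<Longrightarrow> ip (c *\<^sub>R x) y = c * ip x y"
  using inner[unfolded inner_product_on_def, THEN conjunct2, THEN conjunct2, THEN conjunct1] by simp

lemma add_right: "x \<in> V \<Longrightarrow> y \<in> V \<Longrightarrow> z \<in> V \<Longrightarrow> ip z (x + y) = ip z x + ip z y"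
  using add_left[of x y z] sym[of z] by simp

lemma scale_right: "x \<in> V \<Longrightarrow> y \<in> V \<Longrightarrow> ip y (c *\<^sub>R x) = c * ip y x"
  using scale_left[of x y c] sym[of y] by simp

lemma diff_left: "x \<in> V \<Longrightarrow> y \<in> V \<Longrightarrow> z \<in> V \<Longrightarrow> ip (x - y) z = ip x z - ip y z"
  using add_left[of "x - y" y z] by simp

lemma diff_right: "x \<in> V \<Longrightarrow> y \<in> V \<Longrightarrow> z \<in> V \<Longrightarrow> ip z (x - y) = ip z x - ip z y"
  using add_right[of "x - y" y z] by simp

lemma zero_left [simp]: "x \<in> V \<Longrightarrow> ip 0 x = 0"
  using scale_left[of x x 0] by simp

lemma zero_right [simp]: "x \<in> V \<Longrightarrow> ip x 0 = 0"
  using scale_right[of x x 0] by simp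

lemma eq_zero_iff [simp]: "x \<in> V \<Longrightarrow> ip x x = 0 \<longleftrightarrow> x = 0"
  using inner zero_left[of x] unfolding inner_product_on_def by (metis less_irrefl)

lemma nonneg: "x \<in> V \<Longrightarrow> 0 \<le> ip x x"
  using inner zero_left[of x] unfolding inner_product_on_def by (metis less_imp_le order_refl)

text \<open>Gram-Schmidt by induction on the spanning set. The functional is generalised because the
  induction hypothesis is applied to two of them: \<open>\<phi>\<close> itself and pairing with the
  new vector.\<close>

lemma riesz_span:
  assumes "finite B" "span B \<subseteq> V"
    and "linear_between (span B) UNIV (\<phi> :: 'a \<Rightarrow> real)"
  shows "\<exists>p\<in>span B. \<forall>s\<in>span B. \<phi> s = ip p s"
  using assms
proof (induction B arbitrary: \<phi> rule: finite_induct)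
  case empty
  then show ?case using linear_between_zero[OF empty(2)] by simp
next
  case (insert b B)
  let ?W = "span B" and ?W' = "span (insert b B)"
  have sub: "?W \<subseteq> ?W'" by (rule span_mono) auto
  with insert.prems have WV: "?W \<subseteq> V" by blast
  have bV: "b \<in> V" using insert.prems by (auto intro: span_base)
  have lin: "linear_between ?W UNIV \<phi>"
    using insert.prems(2) sub unfolding linear_between_def by blast
  obtain p where p: "p \<in> ?W" "\<And>s. s \<in> ?W \<Longrightarrow> \<phi> s = ip p s"
    using insert.IH[OF WV lin] by blast
  \<comment> \<open>The vector representing \<open>ip b\<close> on the old span is the orthogonal
    projection \<open>q\<close> of \<open>b\<close>, so \<open>b - q\<close> is a new direction
    orthogonal to that span.\<close>
  have "linear_between ?W UNIV (ip b)"
    unfolding linear_between_def using WV bV by (auto simp: add_right scale_right subset_iff)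
  then obtain q where q: "q \<in> ?W" "\<And>s. s \<in> ?W \<Longrightarrow> ip b s = ip q s"
    using insert.IH[OF WV] by blast
  define b' where "b' = b - q"
  have b'V: "b' \<in> V" using bV q(1) WV by (auto simp: b'_def)
  have orth: "ip b' s = 0" if "s \<in> ?W" for s
    using that q bV WV by (simp add: b'_def diff_left subset_iff)
  show ?case
  proof (cases "b' = 0")
    case True
    then have "b \<in> ?W" using q(1) by (simp add: b'_def)
    then have "?W' = ?W" by (rule span_redundant)
    then show ?thesis using p by auto
  next
    case False
    have b'W': "b' \<in> ?W'"
      using q(1) sub by (auto simp: b'_def intro!: span_diff intro: span_base)
    \<comment> \<open>Adding a multiple of \<open>b'\<close> to \<open>p\<close> leaves the pairings
      with \<open>?W\<close> unchanged. As \<open>p\<close> is orthogonal to \<open>b'\<close>, this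
      coefficient is the one that gives the value \<open>\<phi> b'\<close> at
      \<open>b'\<close>.\<close>
    define a where "a = \<phi> b' / ip b' b'"
    have "\<phi> s = ip (p + a *\<^sub>R b') s" if "s \<in> ?W'" for s
    proof -
      obtain c where c: "s - c *\<^sub>R b \<in> ?W" using \<open>s \<in> ?W'\<close> by (auto simp: span_insert)
      define w where "w = s - c *\<^sub>R b'"
      \<comment> \<open>Trading \<open>b\<close> for \<open>b'\<close> changes the remainder only by
        a multiple of \<open>q\<close>, which lies in \<open>?W\<close>.\<close>
      have "w = (s - c *\<^sub>R b) + c *\<^sub>R q" by (simp add: w_def b'_def algebra_simps)
      then have w: "w \<in> ?W" using c q(1) by (simp add: span_add span_scale)
      have wV: "w \<in> V" and pV: "p \<in> V" using w p(1) WV by auto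
      have s: "s = w + c *\<^sub>R b'" by (simp add: w_def)
      have "c *\<^sub>R b' \<in> ?W'" "w \<in> ?W'" using b'W' w sub by (auto intro: span_scale)
      then have "\<phi> s = \<phi> w + \<phi> (c *\<^sub>R b')"
        using insert.prems(2) unfolding s linear_between_def by blast
      also have "\<phi> (c *\<^sub>R b') = c * \<phi> b'"
        using insert.prems(2) b'W' unfolding linear_between_def by simp
      also have "\<phi> b' = a * ip b' b'" using False b'V by (simp add: a_def)
      also have "\<phi> w + c * (a * ip b' b') = ip (p + a *\<^sub>R b') s"
        unfolding s using wV pV b'V orth[OF w] orth[OF p(1)] p(2)[OF w] sym[OF pV b'V]
        by (simp add: add_left add_right scale_left scale_right)
      finally show ?thesis .
    qed
    moreover have "p + a *\<^sub>R b' \<in> ?W'" using p(1) sub b'W' by (auto intro: span_add span_scale)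
    ultimately show ?thesis by blast
  qed
qed

lemma riesz:
  assumes "fin_dim_subspace W" "W \<subseteq> V" "linear_between W UNIV (\<phi> :: 'a \<Rightarrow> real)"
  obtains p where "p \<in> W" "\<And>s. s \<in> W \<Longrightarrow> \<phi> s = ip p s"
proof -
  obtain B where "finite B" "W = span B" using assms(1) by (auto simp: fin_dim_subspace_def)
  then show thesis using riesz_span[of B \<phi>] assms(2,3) that by blast
qed

text \<open>The projection of \<open>x\<close> is the Riesz representative in \<open>W\<close> of
  the functional \<open>ip x\<close>.\<close>

lemma orth_projection_exists:
  assumes "fin_dim_subspace W" "W \<subseteq> V" "x \<in> V"
  obtains p where "p \<in> W" "\<And>s. s \<in> W \<Longrightarrow> ip (x - p) s = 0"
proof -
  have "linear_between W UNIV (ip x)"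
    unfolding linear_between_def using assms by (auto simp: add_right scale_right subset_iff)
  from riesz[OF assms(1,2) this] obtain p where "p \<in> W" "\<And>s. s \<in> W \<Longrightarrow> ip x s = ip p s"
    by blast
  with assms show thesis by (intro that[of p]) (auto simp: diff_left subset_iff)
qed

lemma orth_proj_eqI:
  assumes "S \<subseteq> V" "x \<in> V" "p \<in> S" "\<And>s. s \<in> S \<Longrightarrow> ip (x - p) s = 0"
  shows "orth_proj ip S x = p"
  unfolding orth_proj_def
proof (rule the_equality)
  fix q assume q: "q \<in> S \<and> (\<forall>s\<in>S. ip (x - q) s = 0)"
  have V: "p \<in> V" "q \<in> V" using assms q by auto
  have "ip (q - p) s = 0" if "s \<in> S" for s
  proof -
    have "s \<in> V" using that assms by auto
    moreover have "ip (x - q) s = 0" "ip (x - p) s = 0" using that q assms(4) by auto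
    ultimately show ?thesis using assms(2) V by (simp add: diff_left)
  qed
  \<comment> \<open>Orthogonality is available against members of \<open>S\<close>, so it is used
    for \<open>q\<close> and \<open>p\<close> separately.\<close>
  then have "ip (q - p) (q - p) = 0" using q assms(3) V by (simp add: diff_right)
  then show "q = p" using V by simp
qed (use assms in auto)

lemma adjoint_on_eqI:
  assumes "x \<in> V" "\<And>u. u \<in> V \<Longrightarrow> ipW (g u) y = ip u x"
  shows "adjoint_on V ip ipW g y = x"
  unfolding adjoint_on_def
proof (rule the_equality)
  fix x' assume x': "x' \<in> V \<and> (\<forall>u\<in>V. ipW (g u) y = ip u x')"
  \<comment> \<open>Both candidates are tested on the vector \<open>u = x' - x\<close>.\<close>
  have "ip (x' - x) x' = ip (x' - x) x"
    using x' assms(1) assms(2)[of "x' - x"] by (metis closed(3))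
  then have "ip (x' - x) (x' - x) = 0" using x' assms(1) by (simp add: diff_right)
  then show "x' = x" using x' assms(1) by simp
qed (use assms in auto)

end

text \<open>The adjoint value is the Riesz representative of the functional sending \<open>u\<close>
  to \<open>ipW (g u) y\<close>. This existence result gives the definite description its
  meaning.\<close>

lemma adjoint_on:
  assumes "ip_subspace U ipU" "ip_subspace W ipW" "fin_dim_subspace U"
    and g: "linear_between U W g" and y: "y \<in> W"
  shows "adjoint_on U ipU ipW g y \<in> U"
    and "u \<in> U \<Longrightarrow> ipW (g u) y = ipU u (adjoint_on U ipU ipW g y)"
proof -
  interpret U: ip_subspace U ipU by fact
  interpret W: ip_subspace W ipW by fact
  have "linear_between U UNIV (\<lambda>u. ipW (g u) y)"
    using g y unfolding linear_between_def by (simp add: W.add_left W.scale_left)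
  from U.riesz[OF assms(3) subset_refl this] obtain p
    where p: "p \<in> U" "\<And>u. u \<in> U \<Longrightarrow> ipW (g u) y = ipU p u" by blast
  have p': "ipW (g u) y = ipU u p" if "u \<in> U" for u
    using p that U.sym by simp
  have eq: "adjoint_on U ipU ipW g y = p"
    by (rule U.adjoint_on_eqI[where ipW = ipW and g = g and y = y, OF p(1) p'])
  show "adjoint_on U ipU ipW g y \<in> U" using eq p(1) by simp
  show "ipW (g u) y = ipU u (adjoint_on U ipU ipW g y)" if "u \<in> U"
    using eq p'[OF that] by simp
qed

text \<open>A maximal independent subset of \<open>W\<close> is independent inside the span of a
  finite set, hence finite.\<close>

lemma fin_dim_subspace_subset:
  assumes "fin_dim_subspace V" "subspace W" "W \<subseteq> V"
  shows "fin_dim_subspace W"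
proof -
  obtain A where A: "finite A" "V = span A" using assms(1) by (auto simp: fin_dim_subspace_def)
  obtain B where B: "B \<subseteq> W" "independent B" "W \<subseteq> span B" using maximal_independent_subset by blast
  have "finite B" using independent_span_bound[of A B] A B assms(3) by auto
  moreover have "W = span B" using B span_minimal[OF B(1) assms(2)] by auto
  ultimately show ?thesis by (auto simp: fin_dim_subspace_def)
qed

section \<open>Harmonics of a chain complex\<close>

context
  fixes K :: "'a::real_vector ip_complex"
  assumes K: "chain_complex K"
begin

lemma ip_subspace_chain_space: "ip_subspace (chain_space K k) (ip K k)"
  using K chain_complexD(1)[OF K] by (simp add: ip_subspace_def chain_complex_def)

text \<open>Since \<open>0 - 1 = 0\<close> on naturals, in degree 0 the target \<open>{0}\<close> is
  viewed inside \<open>chain_space K 0\<close>. Later arguments then treat all degrees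
  alike.\<close>

lemma bd_target_subset: "bd_target K k \<subseteq> chain_space K (k - 1)"
  using subspace_0[OF chain_complexD(1)[OF K, of 0]] by (cases k) (auto simp: bd_target_def)

lemma linear_between_bd: "linear_between (chain_space K k) (chain_space K (k - 1)) (bd K k)"
  using chain_complexD(2)[OF K, of k] bd_target_subset[of k] unfolding linear_between_def by blast

lemma bd_in: "x \<in> chain_space K k \<Longrightarrow> bd K k x \<in> chain_space K (k - 1)"
  using linear_between_bd unfolding linear_between_def by blast

lemma bd_zero: "bd K k 0 = 0"
  using linear_between_zero[OF linear_between_bd chain_complexD(1)[OF K]] .

lemma bd_adj:
  assumes "y \<in> chain_space K (k - 1)"
  shows "bd_adj K k y \<in> chain_space K k"
    and "u \<in> chain_space K k \<Longrightarrow> ip K (k - 1) (bd K k u) y = ip K k u (bd_adj K k y)"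
proof -
  have "fin_dim_subspace (chain_space K k)" using K by (simp add: chain_complex_def)
  note adj = adjoint_on[OF ip_subspace_chain_space ip_subspace_chain_space this linear_between_bd assms]
  show "bd_adj K k y \<in> chain_space K k" using adj(1) by (simp add: bd_adj_def)
  show "ip K (k - 1) (bd K k u) y = ip K k u (bd_adj K k y)" if "u \<in> chain_space K k"
    using adj(2)[OF that] by (simp add: bd_adj_def)
qed

text \<open>For \<open>y\<close> orthogonal to the image of the boundary map, the vector 0 satisfies
  the defining property of the adjoint value.\<close>

lemma bd_adj_eq_zero:
  assumes "\<And>u. u \<in> chain_space K k \<Longrightarrow> ip K (k - 1) (bd K k u) y = 0"
  shows "bd_adj K k y = 0"
proof -
  interpret ip_subspace "chain_space K k" "ip K k" by (rule ip_subspace_chain_space)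
  show ?thesis unfolding bd_adj_def using assms by (intro adjoint_on_eqI) auto
qed

lemma subspace_boundaries: "subspace (boundaries K k)"
  unfolding boundaries_def
  by (rule subspace_image_between[OF chain_complexD(2)[OF K] chain_complexD(1)[OF K]])

lemma subspace_cycles: "subspace (cycles K k)"
proof -
  note S = chain_complexD(1)[OF K, of k]
  show ?thesis
    using linear_between_bd[of k] bd_zero[of k] subspace_0[OF S] subspace_add[OF S] subspace_scale[OF S]
    unfolding subspace_def cycles_def linear_between_def by auto
qed

lemma boundaries_subset_cycles: "boundaries K k \<subseteq> cycles K k"
  using bd_in[of _ "Suc k"] K by (auto simp: boundaries_def cycles_def chain_complex_def)

lemma harmonics_eq: "harmonics K k = {h \<in> cycles K k. \<forall>b\<in>boundaries K k. ip K k b h = 0}"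
proof (intro set_eqI iffI)
  interpret k: ip_subspace "chain_space K k" "ip K k" by (rule ip_subspace_chain_space)
  interpret p: ip_subspace "chain_space K (k - 1)" "ip K (k - 1)" by (rule ip_subspace_chain_space)
  interpret s: ip_subspace "chain_space K (Suc k)" "ip K (Suc k)" by (rule ip_subspace_chain_space)
  fix h
  {
    assume "h \<in> harmonics K k"
    then have h: "h \<in> chain_space K k" and L: "laplacian K k h = 0"
      by (auto simp: harmonics_def)
    define c where "c = bd_adj K (Suc k) h"
    have c: "c \<in> chain_space K (Suc k)" using bd_adj(1)[of h "Suc k"] h by (simp add: c_def)
    have adj: "ip K k (bd K (Suc k) u) h = ip K (Suc k) u c" if "u \<in> chain_space K (Suc k)" for u
      using bd_adj(2)[of h "Suc k" u] h that by (simp add: c_def)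
    have dc: "bd K (Suc k) c \<in> chain_space K k" using bd_in[OF c] by simp
    note dh = bd_in[OF h] and e = bd_adj(1)[OF bd_in[OF h]]
    \<comment> \<open>Moving the adjoints across turns the pairing into the squared norm of
      \<open>c\<close>, the adjoint boundary of \<open>h\<close>, plus that of
      \<open>bd K k h\<close>. Both are nonnegative, so both vanish; \<open>c = 0\<close> then gives
      orthogonality to boundaries through \<open>adj\<close>.\<close>
    have "0 = ip K k (laplacian K k h) h" using L h by simp
    also have "\<dots> = ip K k (bd K (Suc k) c) h + ip K k (bd_adj K k (bd K k h)) h"
      using dc e h by (simp add: laplacian_def c_def k.add_left)
    also have "\<dots> = ip K (Suc k) c c + ip K (k - 1) (bd K k h) (bd K k h)"
      using adj[OF c] bd_adj(2)[OF dh h] k.sym[OF e h] by simp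
    finally have "ip K (Suc k) c c + ip K (k - 1) (bd K k h) (bd K k h) = 0" by simp
    then have "ip K (Suc k) c c = 0" "ip K (k - 1) (bd K k h) (bd K k h) = 0"
      using s.nonneg[OF c] p.nonneg[OF dh] by linarith+
    then have "c = 0" "bd K k h = 0" using s.eq_zero_iff[OF c] p.eq_zero_iff[OF dh] by blast+
    then show "h \<in> {h \<in> cycles K k. \<forall>b\<in>boundaries K k. ip K k b h = 0}"
      using h adj by (auto simp: cycles_def boundaries_def)
  next
    assume *: "h \<in> {h \<in> cycles K k. \<forall>b\<in>boundaries K k. ip K k b h = 0}"
    then have h: "h \<in> chain_space K k" "bd K k h = 0" by (auto simp: cycles_def)
    \<comment> \<open>Each summand of the Laplacian vanishes: the first because \<open>h\<close> is
      orthogonal to boundaries, the second because \<open>bd K k h = 0\<close> and the adjoint sends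
      0 to 0.\<close>
    have "bd_adj K (Suc k) h = 0"
      using * by (intro bd_adj_eq_zero) (auto simp: boundaries_def)
    moreover have "bd_adj K k 0 = 0"
      by (intro bd_adj_eq_zero p.zero_right bd_in)
    ultimately show "h \<in> harmonics K k"
      using h bd_zero by (simp add: harmonics_def laplacian_def)
  }
qed

lemma orth_proj_harmonics_homologous:
  assumes z: "z \<in> cycles K k"
  shows "(z, orth_proj (ip K k) (harmonics K k) z) \<in> homologous K k"
proof -
  interpret ip_subspace "chain_space K k" "ip K k" by (rule ip_subspace_chain_space)
  have cyc: "cycles K k \<subseteq> chain_space K k" by (auto simp: cycles_def)
  have bdV: "boundaries K k \<subseteq> chain_space K k" using boundaries_subset_cycles cyc by blast
  have "fin_dim_subspace (chain_space K k)" using K by (simp add: chain_complex_def)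
  then have "fin_dim_subspace (boundaries K k)"
    using fin_dim_subspace_subset subspace_boundaries bdV by blast
  then obtain b where b: "b \<in> boundaries K k" "\<And>s. s \<in> boundaries K k \<Longrightarrow> ip K k (z - b) s = 0"
    using orth_projection_exists[OF _ bdV] z cyc by blast
  have zb: "z - b \<in> cycles K k"
    using z b(1) boundaries_subset_cycles by (blast intro: subspace_diff[OF subspace_cycles])
  have "ip K k s (z - b) = 0" if "s \<in> boundaries K k" for s
    using sym[of s "z - b"] that b(2) zb cyc bdV by auto
  with zb have harm: "z - b \<in> harmonics K k" by (auto simp: harmonics_eq)
  \<comment> \<open>The residual \<open>z - (z - b)\<close> is the boundary \<open>b\<close>, to
    which every harmonic is orthogonal; uniqueness of projections identifies the two sides.\<close>
  have "orth_proj (ip K k) (harmonics K k) z = z - b"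
  proof (rule orth_proj_eqI)
    show "ip K k (z - (z - b)) s = 0" if "s \<in> harmonics K k" for s
      using that b(1) by (simp add: harmonics_eq)
  qed (use z cyc harm in \<open>auto simp: harmonics_def\<close>)
  then show ?thesis using z zb b(1) by (simp add: homologous_def)
qed

end

theorem theorem6p4:
  fixes C :: "'a::real_vector ip_complex" and D :: "'b::real_vector ip_complex"
    and f :: "nat \<Rightarrow> 'a \<Rightarrow> 'b" and k :: nat
  assumes "chain_complex C" and "chain_complex D" and "chain_map C D f"
  shows "\<forall>h\<in>harmonics C k.
    (psi D k \<circ> harmonic_map C D f k) h = (induced C D f k \<circ> psi C k) h"
proof
  fix h assume "h \<in> harmonics C k"
  then have h: "h \<in> cycles C k" by (simp add: harmonics_eq[OF assms(1)])
  \<comment> \<open>The reflexive pair serves to read off from \<open>chain_map_homologous\<close>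
    that \<open>f k h\<close> is a cycle.\<close>
  then have "(h, h) \<in> homologous C k"
    using equiv_class_self[OF equiv_homologous[OF assms(1)]] by blast
  then have "f k h \<in> cycles D k"
    using chain_map_homologous[OF assms, of h h k] by (simp add: homologous_def)
  then have "(f k h, harmonic_map C D f k h) \<in> homologous D k"
    unfolding harmonic_map_def by (rule orth_proj_harmonics_homologous[OF assms(2)])
  \<comment> \<open>Both sides of the square send \<open>h\<close> to the class of
    \<open>f k h\<close>.\<close>
  then have "hom_class D k (harmonic_map C D f k h) = hom_class D k (f k h)"
    unfolding hom_class_def using equiv_class_eq[OF equiv_homologous[OF assms(2)]] by metis
  then show "(psi D k \<circ> harmonic_map C D f k) h = (induced C D f k \<circ> psi C k) h"
    by (simp add: psi_def induced_hom_class[OF assms h])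
qed

end
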